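(* Let $\varphi=\varphi(t)$ be the Kuranishi data of a holomorphic family $\pi:\mathfrak{X}\to\Delta$ of compact complex manifolds with central fiber $X_0$ and nearby fibers $X_t$ ($t$ small). Let $f$ be a smooth function on $X_0$. Then $$df=e^{i_{\varphi}|i_{\overline{\varphi}}}\Big((\mathbf{1}-\varphi\overline{\varphi})^{-1}\lrcorner(\partial-\overline{\varphi}\lrcorner\overline{\partial})f+(\mathbf{1}-\overline{\varphi}\varphi)^{-1}\lrcorner(\overline{\partial}-\varphi\lrcorner\partial)f\Big).$$
   Context: Setting. $\pi:\mathfrak{X}\to\Delta$ is a holomorphic family of $n$-dimensional compact complex manifolds over a small disk $\Delta\subset\mathbb{C}$, with central fiber $X_0$ and fibers $X_t=\pi^{-1}(t)$. A transversely holomorphic trivialization $\mathfrak{X}\cong X_0\times\Delta$ is fixed, by which $X_t$ is identified with $X_0$ as a smooth manifold. It yields the Kuranishi data $\varphi=\varphi(t)\in A^{0,1}(X_0,T^{1,0}_{X_0})$, depending holomorphically on $t$, with $\varphi(0)=0$ and $\overline{\partial}\varphi=\frac12[\varphi,\varphi]$. In local holomorphic coordinates $z$ on $X_0$, write $\varphi=\sum\varphi^i_{\bar k}\,d\bar z^k\otimes\partial/\partial z^i$; the forms $e^{i_\varphi}(dz^i)=dz^i+\varphi^i_{\bar k}d\bar z^k$ are a local frame of $T^{*(1,0)}_{X_t}$ and their conjugates a local frame of $T^{*(0,1)}_{X_t}$. $t$ is small enough that the inverses below exist. Functions are complex-valued; $\partial,\overline{\partial}$ are those of $X_0$; $d$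 is the exterior derivative. Contraction. For a vector-valued form $\eta\otimes v$ ($\eta$ a form, $v$ a complex vector field), $(\eta\otimes v)\lrcorner\alpha=\eta\wedge(v\lrcorner\alpha)$, extended linearly; $i_\varphi=\varphi\lrcorner$. If $\alpha$ is itself a vector-valued form, contraction acts on its form part. Exponentials. $e^{i_\varphi}=\sum_{k\ge0}\frac1{k!}i_\varphi^k$, and similarly $e^{i_{\overline{\varphi}}}$. The map $e^{i_{\varphi}|i_{\overline{\varphi}}}:A^{p,q}(X_0)\to A^{p,q}(X_t)$ on smooth $(p,q)$-forms sends $\omega=\sum\frac1{p!q!}\omega_{i_1\cdots i_p;j_1\cdots j_q}dz^{i_1}\wedge\cdots\wedge dz^{i_p}\wedge d\bar z^{j_1}\wedge\cdots\wedge d\bar z^{j_q}$ to $\sum\frac1{p!q!}\omega_{i_1\cdots i_p;j_1\cdots j_q}\,e^{i_\varphi}(dz^{i_1}\wedge\cdots\wedge dz^{i_p})\wedge e^{i_{\overline{\varphi}}}(d\bar z^{j_1}\wedge\cdots\wedge d\bar z^{j_q})$; it is extended additively to sums of forms of different types. Products. $\overline{\varphi}\varphi:=\varphi\lrcorner\overline{\varphi}=\sum\overline{\varphi}^{\bar i}_{k}\varphi^k_{\bar l}\,d\bar z^l\otimes\partial/\partial\bar z^i$ and $\varphi\overline{\varphi}:=\overline{\varphi}\lrcorner\varphi=\sum\varphi^i_{\bar k}\overline{\varphi}^{\bar k}_{l}\,dz^l\otimes\partial/\partial z^i$. $\mathbf{1}$ is the identity (of $T^{0,1}_{X_0}$ next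 to $\overline{\varphi}\varphi$, of $T^{1,0}_{X_0}$ next to $\varphi\overline{\varphi}$); inverses are taken as endomorphisms, and the results are regarded as vector-valued $1$-forms. *)

theory Defs
  imports "HOL-Analysis.Analysis" "HOL-Library.Function_Algebras"
begin

section \<open>Calculus on open subsets of complex coordinate space\<close>

primrec iter_deriv ::
  "'a list \<Rightarrow> ('a::real_normed_vector \<Rightarrow> 'b::real_normed_vector) \<Rightarrow> 'a \<Rightarrow> 'b" where
  "iter_deriv [] f = f"
| "iter_deriv (v # vs) f = (\<lambda>x. frechet_derivative (iter_deriv vs f) (at x) v)"

text \<open>Smoothness (all iterated directional derivatives exist and are differentiable) in the real sense; used for open \<open>S\<close> only.\<close>

definition smooth_on ::
  "'a::real_normed_vector set \<Rightarrow> ('a \<Rightarrow> 'b::real_normed_vector) \<Rightarrow> bool" where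
  "smooth_on S f \<longleftrightarrow> (\<forall>vs. \<forall>x\<in>S. iter_deriv vs f differentiable (at x))"

text \<open>Holomorphy in several variables; used for open \<open>S\<close> only.\<close>

definition mholomorphic_on ::
  "(complex^'m::finite) set \<Rightarrow> (complex^'m \<Rightarrow> complex) \<Rightarrow> bool" where
  "mholomorphic_on S f \<longleftrightarrow>
     (\<forall>x\<in>S. \<exists>D. (f has_derivative D) (at x) \<and> (\<forall>a v. D (a *s v) = a * D v))"

definition wirt :: "'n::finite \<Rightarrow> (complex^'n \<Rightarrow> complex) \<Rightarrow> complex^'n \<Rightarrow> complex" where
  "wirt i g w = (frechet_derivative g (at w) (axis i 1)
                 - \<i> * frechet_derivative g (at w) (axis i \<i>)) / 2"

definition wirtbar :: "'n::finite \<Rightarrow> (complex^'n \<Rightarrow> complex) \<Rightarrow> complex^'n \<Rightarrow> complex" where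
  "wirtbar i g w = (frechet_derivative g (at w) (axis i 1)
                    + \<i> * frechet_derivative g (at w) (axis i \<i>)) / 2"

section \<open>Complex manifolds\<close>

text \<open>A chart is a pair of a domain and a coordinate map; the values of the coordinate map
  outside the domain are irrelevant.\<close>

type_synonym ('p, 'n) chart = "'p set \<times> ('p \<Rightarrow> complex^'n)"

definition chart_inv :: "('p, 'n::finite) chart \<Rightarrow> complex^'n \<Rightarrow> 'p" where
  "chart_inv c = inv_into (fst c) (snd c)"

definition top_chart :: "'p topology \<Rightarrow> ('p, 'n::finite) chart \<Rightarrow> bool" where
  "top_chart X c \<longleftrightarrow> openin X (fst c) \<and> open (snd c ` fst c) \<and>
     homeomorphic_map (subtopology X (fst c)) (top_of_set (snd c ` fst c)) (snd c)"

definition holo_transition :: "('p, 'n::finite) chart \<Rightarrow> ('p, 'n) chart \<Rightarrow> bool" where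
  "holo_transition c c' \<longleftrightarrow>
     (\<forall>i. mholomorphic_on (snd c ` (fst c \<inter> fst c')) (\<lambda>w. snd c' (chart_inv c w) $ i))"

definition complex_manifold :: "'p topology \<Rightarrow> ('p, 'n::finite) chart set \<Rightarrow> bool" where
  "complex_manifold X A \<longleftrightarrow>
     Hausdorff_space X \<and> second_countable X \<and>
     (\<forall>c\<in>A. top_chart X c) \<and> (\<Union>c\<in>A. fst c) = topspace X \<and>
     (\<forall>c\<in>A. \<forall>c'\<in>A. holo_transition c c')"

text \<open>All holomorphic charts of the manifold, i.e. the maximal atlas.\<close>

definition holo_charts ::
    "'p topology \<Rightarrow> ('p, 'n::finite) chart set \<Rightarrow> ('p, 'n) chart set" where
  "holo_charts X A =
     {c. top_chart X c \<and> (\<forall>c'\<in>A. holo_transition c c' \<and> holo_transition c' c)}"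

text \<open>In the following definitions \<open>M\<close> and \<open>N\<close> stand for the set of holomorphic charts.\<close>

definition smooth_function :: "('p, 'n::finite) chart set \<Rightarrow> ('p \<Rightarrow> complex) \<Rightarrow> bool" where
  "smooth_function M f \<longleftrightarrow> (\<forall>c\<in>M. smooth_on (snd c ` fst c) (f \<circ> chart_inv c))"

definition smooth_map ::
  "'p topology \<Rightarrow> ('p, 'm::finite) chart set \<Rightarrow> 'q topology \<Rightarrow> ('q, 'n::finite) chart set
    \<Rightarrow> ('p \<Rightarrow> 'q) \<Rightarrow> bool" where
  "smooth_map X M Y N g \<longleftrightarrow> continuous_map X Y g \<and>
     (\<forall>c\<in>M. \<forall>c'\<in>N. smooth_on (snd c ` (fst c \<inter> g -` fst c')) (snd c' \<circ> g \<circ> chart_inv c))"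

definition diffeo ::
  "'p topology \<Rightarrow> ('p, 'm::finite) chart set \<Rightarrow> 'q topology \<Rightarrow> ('q, 'n::finite) chart set
    \<Rightarrow> ('p \<Rightarrow> 'q) \<Rightarrow> bool" where
  "diffeo X M Y N g \<longleftrightarrow> bij_betw g (topspace X) (topspace Y) \<and>
     smooth_map X M Y N g \<and> smooth_map Y N X M (inv_into (topspace X) g)"

section \<open>Holomorphic families\<close>

text \<open>The disk is \<open>ball 0 r\<close>. The fibres have dimension \<open>CARD('n)\<close>; coordinates of the total
  space are indexed by \<^typ>\<open>'n option\<close>, so that it has dimension \<open>CARD('n) + 1\<close>.
  The projection is a proper surjective holomorphic submersion.\<close>

definition holomorphic_family ::
  "'p topology \<Rightarrow> ('p, 'n::finite option) chart set \<Rightarrow> real \<Rightarrow> ('p \<Rightarrow> complex) \<Rightarrow> bool" where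
  "holomorphic_family X A r p \<longleftrightarrow>
     complex_manifold X A \<and> r > 0 \<and>
     continuous_map X (top_of_set (ball 0 r)) p \<and> p ` topspace X = ball 0 r \<and>
     proper_map X (top_of_set (ball 0 r)) p \<and>
     (\<forall>c\<in>holo_charts X A. mholomorphic_on (snd c ` fst c) (p \<circ> chart_inv c) \<and>
        (\<forall>x\<in>fst c. surj (frechet_derivative (p \<circ> chart_inv c) (at (snd c x)))))"

definition fibre :: "'p topology \<Rightarrow> ('p \<Rightarrow> complex) \<Rightarrow> complex \<Rightarrow> 'p topology" where
  "fibre X p t = subtopology X {x. p x = t}"

text \<open>The complex structure of a fibre as a submanifold: charts \<open>(z, p)\<close> of the total space
  whose last coordinate (index \<^const>\<open>None\<close>) is the projection restrict to charts \<open>z\<close> of the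
  fibres.\<close>

definition fibre_atlas ::
  "'p topology \<Rightarrow> ('p, 'n::finite option) chart set \<Rightarrow> ('p \<Rightarrow> complex) \<Rightarrow> complex
    \<Rightarrow> ('p, 'n) chart set" where
  "fibre_atlas X A p t =
     {(fst c \<inter> {x. p x = t}, \<lambda>x. \<chi> i. snd c x $ Some i) | c.
        c \<in> holo_charts X A \<and> (\<forall>x\<in>fst c. snd c x $ None = p x)}"

definition fibre_charts ::
  "'p topology \<Rightarrow> ('p, 'n::finite option) chart set \<Rightarrow> ('p \<Rightarrow> complex) \<Rightarrow> complex
    \<Rightarrow> ('p, 'n) chart set" where
  "fibre_charts X A p t = holo_charts (fibre X p t) (fibre_atlas X A p t)"

definition prod_chart ::
    "real \<Rightarrow> ('p, 'n::finite) chart \<Rightarrow> ('p \<times> complex, 'n option) chart" where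
  "prod_chart r c =
     (fst c \<times> ball 0 r, \<lambda>(x, s). \<chi> k. case k of None \<Rightarrow> s | Some i \<Rightarrow> snd c x $ i)"

definition triv_inv ::
  "'p topology \<Rightarrow> ('p \<Rightarrow> complex) \<Rightarrow> ('p \<Rightarrow> 'p) \<Rightarrow> 'p \<times> complex \<Rightarrow> 'p" where
  "triv_inv X p \<sigma> = inv_into (topspace X) (\<lambda>x. (\<sigma> x, p x))"

text \<open>A transversely holomorphic trivialization: a diffeomorphism \<open>(\<sigma>, p)\<close> onto the product of
  the central fibre and the disk, where \<open>\<sigma>\<close> is a retraction onto the central fibre and the
  fibres of \<open>\<sigma>\<close> are holomorphic disks, parametrized by \<open>s \<mapsto> triv_inv X p \<sigma> (x, s)\<close>.\<close>

definition transv_holo_trivialization ::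
  "'p topology \<Rightarrow> ('p, 'n::finite option) chart set \<Rightarrow> real \<Rightarrow> ('p \<Rightarrow> complex)
    \<Rightarrow> ('p \<Rightarrow> 'p) \<Rightarrow> bool" where
  "transv_holo_trivialization X A r p \<sigma> \<longleftrightarrow>
     diffeo X (holo_charts X A)
       (prod_topology (fibre X p 0) (top_of_set (ball 0 r)))
       (holo_charts (prod_topology (fibre X p 0) (top_of_set (ball 0 r)))
          (prod_chart r ` fibre_atlas X A p 0))
       (\<lambda>x. (\<sigma> x, p x)) \<and>
     (\<forall>x\<in>topspace (fibre X p 0). \<sigma> x = x) \<and>
     (\<forall>x\<in>topspace (fibre X p 0). \<forall>c\<in>holo_charts X A. \<forall>k.
        (\<lambda>s. snd c (triv_inv X p \<sigma> (x, s)) $ k)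
          holomorphic_on {s \<in> ball 0 r. triv_inv X p \<sigma> (x, s) \<in> fst c})"

section \<open>Forms and vector-valued forms at a point, in a chart\<close>

text \<open>Elements of \<open>'n cvec\<close> are the complexified tangent vectors at a point, with respect to
  the frame \<open>\<partial>/\<partial>z\<^sup>i\<close> (index \<open>Inl i\<close>), \<open>\<partial>/\<partial>\<bar>z\<^sup>j\<close> (index \<open>Inr j\<close>). A form of mixed
  degree is represented by its values on lists of tangent vectors: its part of degree \<open>k\<close> is its
  restriction to lists of length \<open>k\<close>. The sum of forms is the pointwise one of
  \<^theory>\<open>HOL-Library.Function_Algebras\<close>.\<close>

type_synonym 'n cvec = "complex^('n + 'n)"
type_synonym 'n form = "'n cvec list \<Rightarrow> complex"

definition frame :: "'n::finite + 'n \<Rightarrow> 'n cvec" where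
  "frame a = axis a 1"

definition coframe :: "'n::finite + 'n \<Rightarrow> 'n form" where
  "coframe a = (\<lambda>vs. if length vs = 1 then hd vs $ a else 0)"

abbreviation dz :: "'n::finite \<Rightarrow> 'n form" where "dz i \<equiv> coframe (Inl i)"
abbreviation dzbar :: "'n::finite \<Rightarrow> 'n form" where "dzbar j \<equiv> coframe (Inr j)"

definition unit_form :: "'n::finite form" where
  "unit_form = (\<lambda>vs. if vs = [] then 1 else 0)"

definition fscale :: "complex \<Rightarrow> 'n::finite form \<Rightarrow> 'n form" where
  "fscale a \<alpha> = (\<lambda>vs. a * \<alpha> vs)"

text \<open>The wedge product as a signed sum over shuffles: \<open>S\<close> is the set of positions of the
  arguments that are given to the first factor. In this convention
  \<open>(\<alpha> \<and> \<beta>) [v, w] = \<alpha> [v] * \<beta> [w] - \<alpha> [w] * \<beta> [v]\<close> for 1-forms.\<close>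

definition wedge :: "'n::finite form \<Rightarrow> 'n form \<Rightarrow> 'n form" (infixr "\<and>\<^sub>f" 70) where
  "\<alpha> \<and>\<^sub>f \<beta> = (\<lambda>vs. \<Sum>S\<in>Pow {..<length vs}.
     (- 1) ^ card {(i, j). i < j \<and> j < length vs \<and> i \<notin> S \<and> j \<in> S}
       * \<alpha> (nths vs S) * \<beta> (nths vs (- S)))"

definition wedge_list :: "'n::finite form list \<Rightarrow> 'n form" where
  "wedge_list \<alpha>s = foldr wedge \<alpha>s unit_form"

definition vcontract :: "'n::finite cvec \<Rightarrow> 'n form \<Rightarrow> 'n form" where
  "vcontract v \<alpha> = (\<lambda>vs. \<alpha> (v # vs))"

text \<open>\<open>\<Psi> :: 'n vform\<close> represents the vector-valued form \<open>\<Sum>a. \<Psi> a \<otimes> frame a\<close>.\<close>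

type_synonym 'n vform = "'n + 'n \<Rightarrow> 'n form"

definition contract :: "'n::finite vform \<Rightarrow> 'n form \<Rightarrow> 'n form" (infixr "\<lrcorner>" 75) where
  "\<Psi> \<lrcorner> \<alpha> = (\<Sum>a\<in>UNIV. \<Psi> a \<and>\<^sub>f vcontract (frame a) \<alpha>)"

definition vform_contract :: "'n::finite vform \<Rightarrow> 'n vform \<Rightarrow> 'n vform" (infixr "\<lrcorner>\<^sub>v" 75) where
  "\<Psi> \<lrcorner>\<^sub>v \<Theta> = (\<lambda>b. \<Psi> \<lrcorner> \<Theta> b)"

definition exp_contract :: "'n::finite vform \<Rightarrow> 'n form \<Rightarrow> 'n form" where
  "exp_contract \<Psi> \<alpha> = (\<lambda>vs. \<Sum>k. ((contract \<Psi> ^^ k) \<alpha>) vs / fact k)"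

text \<open>The (0,1)-form with values in \<open>T\<^sup>1\<^sup>,\<^sup>0\<close> with coefficients \<open>\<phi>$i$k\<close> of
  \<open>d\<bar>z\<^sup>k \<otimes> \<partial>/\<partial>z\<^sup>i\<close>, and its conjugate.\<close>

definition beltrami :: "complex^'n^'n \<Rightarrow> 'n::finite vform" where
  "beltrami \<phi> = (\<lambda>a. case a of Inl i \<Rightarrow> (\<Sum>k\<in>UNIV. fscale (\<phi> $ i $ k) (dzbar k)) | Inr i \<Rightarrow> 0)"

definition beltrami_cnj :: "complex^'n^'n \<Rightarrow> 'n::finite vform" where
  "beltrami_cnj \<phi> =
     (\<lambda>a. case a of Inl i \<Rightarrow> 0 | Inr i \<Rightarrow> (\<Sum>k\<in>UNIV. fscale (cnj (\<phi> $ i $ k)) (dz k)))"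

text \<open>The extension map: exponential of contraction with \<open>\<phi>\<close> on the \<open>dz\<close>, of contraction with
  \<open>cnj \<phi>\<close> on the \<open>d\<bar>z\<close>. The coefficient \<open>\<omega>\<^sub>I\<^sub>;\<^sub>J\<close> is the value of \<open>\<omega>\<close> on the corresponding
  frame vectors; thus \<open>exp_exp_pq p q \<phi>\<close> only sees the part of type \<open>(p, q)\<close>.\<close>

definition exp_exp_pq :: "nat \<Rightarrow> nat \<Rightarrow> complex^'n^'n \<Rightarrow> 'n::finite form \<Rightarrow> 'n form" where
  "exp_exp_pq p q \<phi> \<omega> =
     (\<Sum>I\<in>{I. length I = p}. \<Sum>J\<in>{J. length J = q}.
        fscale (\<omega> (map (\<lambda>i. frame (Inl i)) I @ map (\<lambda>j. frame (Inr j)) J) / (fact p * fact q))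
          (exp_contract (beltrami \<phi>) (wedge_list (map dz I))
            \<and>\<^sub>f exp_contract (beltrami_cnj \<phi>) (wedge_list (map dzbar J))))"

definition exp_exp :: "complex^'n^'n \<Rightarrow> 'n::finite form \<Rightarrow> 'n form" where
  "exp_exp \<phi> \<omega> = (\<Sum>p\<le>CARD('n). \<Sum>q\<le>CARD('n). exp_exp_pq p q \<phi> \<omega>)"

text \<open>Vector-valued 1-forms of type \<open>dz \<otimes> \<partial>/\<partial>z\<close> or \<open>d\<bar>z \<otimes> \<partial>/\<partial>\<bar>z\<close> as matrices of
  endomorphisms of \<open>T\<^sup>1\<^sup>,\<^sup>0\<close> or \<open>T\<^sup>0\<^sup>,\<^sup>1\<close>, and conversely.\<close>

definition endo10 :: "'n::finite vform \<Rightarrow> complex^'n^'n" where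
  "endo10 \<Psi> = (\<chi> i l. \<Psi> (Inl i) [frame (Inl l)])"

definition endo01 :: "'n::finite vform \<Rightarrow> complex^'n^'n" where
  "endo01 \<Psi> = (\<chi> i l. \<Psi> (Inr i) [frame (Inr l)])"

definition vform10 :: "complex^'n^'n \<Rightarrow> 'n::finite vform" where
  "vform10 M = (\<lambda>a. case a of Inl i \<Rightarrow> (\<Sum>l\<in>UNIV. fscale (M $ i $ l) (dz l)) | Inr i \<Rightarrow> 0)"

definition vform01 :: "complex^'n^'n \<Rightarrow> 'n::finite vform" where
  "vform01 M = (\<lambda>a. case a of Inl i \<Rightarrow> 0 | Inr i \<Rightarrow> (\<Sum>l\<in>UNIV. fscale (M $ i $ l) (dzbar l)))"

text \<open>The endomorphisms \<open>1 - \<phi> (cnj \<phi>)\<close> of \<open>T\<^sup>1\<^sup>,\<^sup>0\<close> and \<open>1 - (cnj \<phi>) \<phi>\<close> of \<open>T\<^sup>0\<^sup>,\<^sup>1\<close>. Note the order: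
  the product \<open>\<phi> (cnj \<phi>)\<close> is the contraction of the form part of \<open>\<phi>\<close> with \<open>cnj \<phi>\<close>.\<close>

definition one_minus_phi_phibar :: "complex^'n^'n \<Rightarrow> complex^'n::finite^'n" where
  "one_minus_phi_phibar \<phi> = mat 1 - endo10 (beltrami_cnj \<phi> \<lrcorner>\<^sub>v beltrami \<phi>)"

definition one_minus_phibar_phi :: "complex^'n^'n \<Rightarrow> complex^'n::finite^'n" where
  "one_minus_phibar_phi \<phi> = mat 1 - endo01 (beltrami \<phi> \<lrcorner>\<^sub>v beltrami_cnj \<phi>)"

section \<open>Differentials of functions on a manifold, in a chart\<close>

definition chart_wirt :: "('p, 'n::finite) chart \<Rightarrow> 'n \<Rightarrow> ('p \<Rightarrow> complex) \<Rightarrow> 'p \<Rightarrow> complex" where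
  "chart_wirt c i f x = wirt i (f \<circ> chart_inv c) (snd c x)"

definition chart_wirtbar :: "('p, 'n::finite) chart \<Rightarrow> 'n \<Rightarrow> ('p \<Rightarrow> complex) \<Rightarrow> 'p \<Rightarrow> complex" where
  "chart_wirtbar c i f x = wirtbar i (f \<circ> chart_inv c) (snd c x)"

definition del :: "('p, 'n::finite) chart \<Rightarrow> ('p \<Rightarrow> complex) \<Rightarrow> 'p \<Rightarrow> 'n form" where
  "del c f x = (\<Sum>i\<in>UNIV. fscale (chart_wirt c i f x) (dz i))"

definition delbar :: "('p, 'n::finite) chart \<Rightarrow> ('p \<Rightarrow> complex) \<Rightarrow> 'p \<Rightarrow> 'n form" where
  "delbar c f x = (\<Sum>j\<in>UNIV. fscale (chart_wirtbar c j f x) (dzbar j))"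

text \<open>A real tangent vector \<open>u\<close> of coordinate space is \<open>\<Sum>i. u\<^sub>i \<partial>/\<partial>z\<^sup>i + cnj u\<^sub>i \<partial>/\<partial>\<bar>z\<^sup>i\<close>
  as a complexified one; every complexified tangent vector \<open>v\<close> is
  \<open>re_tangent v + \<i> im_tangent v\<close> in this sense.\<close>

definition re_tangent :: "'n::finite cvec \<Rightarrow> complex^'n" where
  "re_tangent v = (\<chi> i. (v $ Inl i + cnj (v $ Inr i)) / 2)"

definition im_tangent :: "'n::finite cvec \<Rightarrow> complex^'n" where
  "im_tangent v = (\<chi> i. (v $ Inl i - cnj (v $ Inr i)) / (2 * \<i>))"

text \<open>The exterior derivative of a function: the complex linear extension of its real
  differential.\<close>

definition ext_d :: "('p, 'n::finite) chart \<Rightarrow> ('p \<Rightarrow> complex) \<Rightarrow> 'p \<Rightarrow> 'n form" where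
  "ext_d c f x = (\<lambda>vs. if length vs = 1
     then frechet_derivative (f \<circ> chart_inv c) (at (snd c x)) (re_tangent (hd vs))
          + \<i> * frechet_derivative (f \<circ> chart_inv c) (at (snd c x)) (im_tangent (hd vs))
     else 0)"

section \<open>Kuranishi data\<close>

text \<open>For \<open>\<phi>\<close> given by its coefficients \<open>\<phi> x $ i $ k\<close> in the chart \<open>c\<close>.\<close>

definition delbar_beltrami ::
    "('p, 'n::finite) chart \<Rightarrow> ('p \<Rightarrow> complex^'n^'n) \<Rightarrow> 'p \<Rightarrow> 'n vform" where
  "delbar_beltrami c \<phi> x = (\<lambda>a. case a of
      Inl i \<Rightarrow> (\<Sum>k\<in>UNIV. delbar c (\<lambda>y. \<phi> y $ i $ k) x \<and>\<^sub>f dzbar k)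
    | Inr i \<Rightarrow> 0)"

text \<open>\<open>[\<phi>, \<psi>] = \<Sum>i j. (\<phi>\<^sup>j \<and> \<partial>\<^sub>j\<psi>\<^sup>i + \<psi>\<^sup>j \<and> \<partial>\<^sub>j\<phi>\<^sup>i) \<otimes> \<partial>/\<partial>z\<^sup>i\<close>, where \<open>\<partial>\<^sub>j\<close> acts on
  coefficients.\<close>

definition bracket ::
    "('p, 'n::finite) chart \<Rightarrow> ('p \<Rightarrow> complex^'n^'n) \<Rightarrow> ('p \<Rightarrow> complex^'n^'n) \<Rightarrow> 'p \<Rightarrow> 'n vform" where
  "bracket c \<phi> \<psi> x = (\<lambda>a. case a of
      Inl i \<Rightarrow> (\<Sum>j\<in>UNIV.
          beltrami (\<phi> x) (Inl j)
            \<and>\<^sub>f (\<Sum>k\<in>UNIV. fscale (chart_wirt c j (\<lambda>y. \<psi> y $ i $ k) x) (dzbar k))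
        + beltrami (\<psi> x) (Inl j)
            \<and>\<^sub>f (\<Sum>k\<in>UNIV. fscale (chart_wirt c j (\<lambda>y. \<phi> y $ i $ k) x) (dzbar k)))
    | Inr i \<Rightarrow> 0)"

definition cspan :: "('n::finite \<Rightarrow> 'm::finite form) \<Rightarrow> 'm form set" where
  "cspan \<theta> = {(\<Sum>i\<in>UNIV. fscale (a i) (\<theta> i)) | a. True}"

text \<open>A family of smooth (0,1)-forms with values in \<open>T\<^sup>1\<^sup>,\<^sup>0\<close> on a manifold with holomorphic
  charts \<open>M\<close>, depending on the chart by the tensor transformation law
  (\<open>wirt i (\<lambda>w. snd c' (chart_inv c w) $ j)\<close> is the Jacobian of the change of coordinates).\<close>

definition vector_form01 ::
    "('p, 'n::finite) chart set \<Rightarrow> (('p, 'n) chart \<Rightarrow> 'p \<Rightarrow> complex^'n^'n) \<Rightarrow> bool" where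
  "vector_form01 M \<phi> \<longleftrightarrow>
     (\<forall>c\<in>M. \<forall>i k. smooth_on (snd c ` fst c) (\<lambda>w. \<phi> c (chart_inv c w) $ i $ k)) \<and>
     (\<forall>c\<in>M. \<forall>c'\<in>M. \<forall>x\<in>fst c \<inter> fst c'.
        let J = (\<chi> j i. wirt i (\<lambda>w. snd c' (chart_inv c w) $ j) (snd c x))
        in \<phi> c' x ** (\<chi> j i. cnj (J $ j $ i)) = J ** \<phi> c x)"

text \<open>\<open>\<phi> t c x\<close> is the matrix of coefficients of \<open>\<phi>(t)\<close> at the point \<open>x\<close> of the central fibre,
  in the chart \<open>c\<close>. The last condition determines \<open>\<phi>(t)\<close>: the (1,0)-cotangent space of the
  fibre over \<open>t\<close>, pulled back to the central fibre by \<open>x \<mapsto> triv_inv X p \<sigma> (x, t)\<close>, is spanned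
  by the forms \<open>exp_contract \<phi>(t) (dz i)\<close>.\<close>

definition kuranishi_data ::
  "'p topology \<Rightarrow> ('p, 'n::finite option) chart set \<Rightarrow> real \<Rightarrow> ('p \<Rightarrow> complex) \<Rightarrow> ('p \<Rightarrow> 'p)
    \<Rightarrow> (complex \<Rightarrow> ('p, 'n) chart \<Rightarrow> 'p \<Rightarrow> complex^'n^'n) \<Rightarrow> bool" where
  "kuranishi_data X A r p \<sigma> \<phi> \<longleftrightarrow>
     (\<forall>t\<in>ball 0 r. vector_form01 (fibre_charts X A p 0) (\<phi> t)) \<and>
     (\<forall>c\<in>fibre_charts X A p 0. \<forall>x\<in>fst c.
        (\<forall>i k. (\<lambda>t. \<phi> t c x $ i $ k) holomorphic_on ball 0 r) \<and>
        \<phi> 0 c x = 0 \<and>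
        (\<forall>t\<in>ball 0 r.
           delbar_beltrami c (\<phi> t c) x = (\<lambda>a. fscale (1 / 2) (bracket c (\<phi> t c) (\<phi> t c) x a)) \<and>
           (\<forall>c'\<in>fibre_charts X A p t. triv_inv X p \<sigma> (x, t) \<in> fst c' \<longrightarrow>
              cspan (\<lambda>i. ext_d c (\<lambda>y. snd c' (triv_inv X p \<sigma> (y, t)) $ i) x)
              = cspan (\<lambda>i. exp_contract (beltrami (\<phi> t c x)) (dz i)))))"

end

theory Submission
  imports Defs
begin

text \<open>
  The identity is pointwise. In the coframe \<open>(dz, d\<bar>z)\<close> write the row vectors of coefficients of
  \<open>\<partial>f\<close>, \<open>\<partial>\<bar>f\<close> as \<open>u\<close>, \<open>v\<close>, and let \<open>P\<close> be the matrix of \<open>\<phi>\<close> and \<open>Q\<close> its conjugate. Since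
  \<open>e\<^sup>i\<^sup>\<phi>\<close> maps \<open>dz\<close> to \<open>dz + P d\<bar>z\<close>, the \<open>dz\<close>-component of the right-hand side is
  \<open>(u - v Q) (1 - P Q)\<inverse> + (v - u P) (1 - Q P)\<inverse> Q\<close>, and \<open>(1 - Q P)\<inverse> Q = Q (1 - P Q)\<inverse>\<close> reduces it
  to \<open>u\<close>. The \<open>d\<bar>z\<close>-component is symmetric.
\<close>

section \<open>Forms of degree at most one\<close>

text \<open>Normal form for 1-forms: row vectors \<open>u\<close> and \<open>v\<close> of
  coefficients with respect to \<open>dz\<close> and \<open>dzbar\<close>. Vanishing on lists of any
  other length makes equality of forms equality of functions, so the theorem reduces to an equation
  between row vectors.\<close>

definition one_form :: "complex^'n \<Rightarrow> complex^'n \<Rightarrow> 'n::finite form" where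
  "one_form u v = (\<lambda>vs. if length vs = 1
     then (\<Sum>i\<in>UNIV. u $ i * hd vs $ Inl i) + (\<Sum>i\<in>UNIV. v $ i * hd vs $ Inr i) else 0)"

lemma sum_UNIV_Plus:
  fixes g :: "'a::finite + 'b::finite \<Rightarrow> 'c::comm_monoid_add"
  shows "(\<Sum>a\<in>UNIV. g a) = (\<Sum>i\<in>UNIV. g (Inl i)) + (\<Sum>j\<in>UNIV. g (Inr j))"
  by (simp add: sum.Plus flip: UNIV_Plus_UNIV)

section \<open>Wedge products with the unit 0-form\<close>

lemma nths_eq_Nil_iff: "nths vs S = [] \<longleftrightarrow> S \<inter> {..<length vs} = {}"
proof -
  have "length (nths vs S) = 0 \<longleftrightarrow> {i. i < length vs \<and> i \<in> S} = {}"
    by (simp only: length_nths card_eq_0_iff) simp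
  then show ?thesis by auto
qed

lemma wedge_zero_right [simp]: "\<alpha> \<and>\<^sub>f 0 = 0"
  by (simp add: wedge_def fun_eq_iff)

lemma wedge_fscale_right: "\<alpha> \<and>\<^sub>f fscale a \<beta> = fscale a (\<alpha> \<and>\<^sub>f \<beta>)"
  by (simp add: wedge_def fscale_def fun_eq_iff sum_distrib_left mult_ac)

text \<open>\<open>unit_form\<close> vanishes on nonempty lists, so only the shuffle giving every
  position to \<alpha> survives; it has no inversions, hence sign 1.\<close>

lemma wedge_unit_right [simp]: "\<alpha> \<and>\<^sub>f unit_form = \<alpha>" for \<alpha> :: "'n::finite form"
proof
  fix vs :: "'n cvec list"
  let ?N = "{..<length vs}"
  let ?g = "\<lambda>S. (- 1) ^ card {(i, j). i < j \<and> j < length vs \<and> i \<notin> S \<and> j \<in> S}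
       * \<alpha> (nths vs S) * unit_form (nths vs (- S))"
  have "(\<alpha> \<and>\<^sub>f unit_form) vs = (\<Sum>S\<in>Pow ?N. ?g S)"
    by (simp add: wedge_def)
  also have "\<dots> = (\<Sum>S\<in>{?N}. ?g S)"
    by (rule sum.mono_neutral_right) (auto simp: unit_form_def nths_eq_Nil_iff)
  also have "\<dots> = ?g ?N"
    by simp
  also have "\<dots> = \<alpha> vs"
  proof -
    have no_inversion: "{(i, j). i < j \<and> j < length vs \<and> i \<notin> ?N \<and> j \<in> ?N} = {}"
      by auto
    have "nths vs (- ?N) = []"
      by (auto simp: nths_eq_Nil_iff)
    then show ?thesis
      by (simp only: no_inversion \<open>nths vs (- ?N) = []\<close> unit_form_def) simp
  qed
  finally show "(\<alpha> \<and>\<^sub>f unit_form) vs = \<alpha> vs" .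
qed

lemma wedge_unit_left [simp]: "unit_form \<and>\<^sub>f \<beta> = \<beta>" for \<beta> :: "'n::finite form"
proof
  fix vs :: "'n cvec list"
  let ?N = "{..<length vs}"
  let ?g = "\<lambda>S. (- 1) ^ card {(i, j). i < j \<and> j < length vs \<and> i \<notin> S \<and> j \<in> S}
       * unit_form (nths vs S) * \<beta> (nths vs (- S))"
  have "(unit_form \<and>\<^sub>f \<beta>) vs = (\<Sum>S\<in>Pow ?N. ?g S)"
    by (simp add: wedge_def)
  also have "\<dots> = (\<Sum>S\<in>{{}}. ?g S)"
    by (rule sum.mono_neutral_right) (auto simp: unit_form_def nths_eq_Nil_iff)
  also have "\<dots> = \<beta> vs"
    by (simp add: unit_form_def nths_all)
  finally show "(unit_form \<and>\<^sub>f \<beta>) vs = \<beta> vs" .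
qed

section \<open>Contraction on forms of degree at most one\<close>

lemma vcontract_unit_form [simp]: "vcontract w unit_form = 0"
  by (simp add: vcontract_def unit_form_def fun_eq_iff)

lemma vcontract_zero [simp]: "vcontract w 0 = 0"
  by (simp add: vcontract_def fun_eq_iff)

lemma contract_unit_form [simp]: "\<Psi> \<lrcorner> unit_form = 0"
  by (simp add: contract_def)

lemma contract_zero [simp]: "\<Psi> \<lrcorner> 0 = 0"
  by (simp add: contract_def)

lemma frame_nth: "frame a $ b = (if b = a then 1 else 0)"
  by (simp add: frame_def axis_def)

lemma vcontract_Inl_one_form: "vcontract (frame (Inl i)) (one_form u v) = fscale (u $ i) unit_form"
  by (auto simp: vcontract_def one_form_def fscale_def unit_form_def fun_eq_iff frame_nth
      if_distrib[of "(*) _"] cong: if_cong)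

lemma vcontract_Inr_one_form: "vcontract (frame (Inr i)) (one_form u v) = fscale (v $ i) unit_form"
  by (auto simp: vcontract_def one_form_def fscale_def unit_form_def fun_eq_iff frame_nth
      if_distrib[of "(*) _"] cong: if_cong)

text \<open>Contracting a 1-form with a frame vector leaves a multiple of \<open>unit_form\<close>,
  so the wedge with the form part of \<Psi> is mere scaling.\<close>

lemma contract_one_form:
  "\<Psi> \<lrcorner> one_form u v
     = (\<Sum>i\<in>UNIV. fscale (u $ i) (\<Psi> (Inl i))) + (\<Sum>i\<in>UNIV. fscale (v $ i) (\<Psi> (Inr i)))"
  by (simp add: contract_def sum_UNIV_Plus vcontract_Inl_one_form vcontract_Inr_one_form
      wedge_fscale_right)

section \<open>Arithmetic of coefficient vectors\<close>

lemma one_form_add: "one_form u v + one_form u' v' = one_form (u + u') (v + v')"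
  by (simp add: one_form_def fun_eq_iff sum.distrib ring_distribs)

lemma one_form_diff: "one_form u v - one_form u' v' = one_form (u - u') (v - v')"
  by (simp add: one_form_def fun_eq_iff sum_subtractf ring_distribs)

lemma one_form_zero [simp]: "one_form 0 0 = 0"
  by (simp add: one_form_def fun_eq_iff)

lemma fscale_one_form: "fscale a (one_form u v) = one_form (a *s u) (a *s v)"
  by (simp add: one_form_def fscale_def fun_eq_iff sum_distrib_left ring_distribs mult_ac)

lemma fscale_zero_left [simp]: "fscale 0 \<alpha> = 0"
  by (simp add: fscale_def fun_eq_iff)

lemma fscale_zero_right [simp]: "fscale a 0 = 0"
  by (simp add: fscale_def fun_eq_iff)

lemma sum_one_form: "(\<Sum>i\<in>S. one_form (F i) (G i)) = one_form (sum F S) (sum G S)"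
  by (induction S rule: infinite_finite_induct) (auto simp: one_form_add)

lemma dz_eq_one_form: "dz i = one_form (axis i 1) 0"
  by (simp add: coframe_def one_form_def fun_eq_iff axis_def if_distrib[of "\<lambda>x. x * _"] cong: if_cong)

lemma dzbar_eq_one_form: "dzbar i = one_form 0 (axis i 1)"
  by (simp add: coframe_def one_form_def fun_eq_iff axis_def if_distrib[of "\<lambda>x. x * _"] cong: if_cong)

lemma sum_fscale_dz: "(\<Sum>i\<in>UNIV. fscale (a i) (dz i)) = one_form (\<chi> i. a i) 0"
  by (auto simp: dz_eq_one_form fscale_one_form sum_one_form intro!: arg_cong2[where f = one_form]
      simp: vec_eq_iff axis_def if_distrib[of "(*) _"] cong: if_cong)

lemma sum_fscale_dzbar: "(\<Sum>i\<in>UNIV. fscale (a i) (dzbar i)) = one_form 0 (\<chi> i. a i)"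
  by (auto simp: dzbar_eq_one_form fscale_one_form sum_one_form intro!: arg_cong2[where f = one_form]
      simp: vec_eq_iff axis_def if_distrib[of "(*) _"] cong: if_cong)

section \<open>Contractions and exponentials as matrices\<close>

text \<open>This is why contraction acts on coefficient rows by right multiplication: row
  \<open>i\<close> of the matrix holds the form part belonging to the \<open>i\<close>-th frame
  vector.\<close>

lemma sum_scale_rows: "(\<Sum>i\<in>UNIV. u $ i *s M $ i) = u v* M"
  for u :: "complex^'n::finite"
  by (simp add: vec_eq_iff vector_matrix_mult_def mult_ac)

lemma contract_vform10: "vform10 M \<lrcorner> one_form u v = one_form (u v* M) 0"
  by (simp add: contract_one_form vform10_def sum_fscale_dz fscale_one_form sum_one_form sum_scale_rows)

lemma contract_vform01: "vform01 M \<lrcorner> one_form u v = one_form 0 (v v* M)"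
  by (simp add: contract_one_form vform01_def sum_fscale_dzbar fscale_one_form sum_one_form sum_scale_rows)

lemma contract_beltrami: "beltrami P \<lrcorner> one_form u v = one_form 0 (u v* P)"
  by (simp add: contract_one_form beltrami_def sum_fscale_dzbar fscale_one_form sum_one_form sum_scale_rows)

lemma contract_beltrami_cnj: "beltrami_cnj P \<lrcorner> one_form u v = one_form (v v* map_matrix cnj P) 0"
  using sum_scale_rows[of v "map_matrix cnj P"]
  by (simp add: contract_one_form beltrami_cnj_def sum_fscale_dz fscale_one_form sum_one_form
      map_matrix_def)

text \<open>The form part of \<phi> at index \<open>i\<close> is row \<open>i\<close> of
  \<open>P\<close>; contracting it with the conjugate multiplies that row on the right, which fixes
  the order of the product. Evaluation on frame vectors reads off the entries.\<close>

lemma one_minus_phi_phibar_eq: "one_minus_phi_phibar P = mat 1 - P ** map_matrix cnj P"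
proof -
  have "(beltrami_cnj P \<lrcorner>\<^sub>v beltrami P) (Inl i) = one_form ((\<chi> k. P $ i $ k) v* map_matrix cnj P) 0" for i
    by (simp add: vform_contract_def beltrami_def sum_fscale_dzbar contract_beltrami_cnj)
  then show ?thesis
    by (simp add: one_minus_phi_phibar_def endo10_def one_form_def frame_nth vec_eq_iff
        vector_matrix_mult_def matrix_matrix_mult_def if_distrib[of "(*) _"] cong: if_cong)
qed

lemma one_minus_phibar_phi_eq: "one_minus_phibar_phi P = mat 1 - map_matrix cnj P ** P"
proof -
  have "(beltrami P \<lrcorner>\<^sub>v beltrami_cnj P) (Inr i) = one_form 0 ((\<chi> k. map_matrix cnj P $ i $ k) v* P)" for i
    by (simp add: vform_contract_def beltrami_cnj_def sum_fscale_dz contract_beltrami)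
  then show ?thesis
    by (simp add: one_minus_phibar_phi_def endo01_def one_form_def frame_nth vec_eq_iff
        vector_matrix_mult_def matrix_matrix_mult_def if_distrib[of "(*) _"] cong: if_cong)
qed

text \<open>The exponential series stops after its linear term. On 1-forms this applies to \<phi>,
  which sends \<open>dz\<close> to \<open>dzbar\<close> forms and kills the latter, and likewise to
  its conjugate.\<close>

lemma exp_contract_square_zero:
  assumes "\<Psi> \<lrcorner> \<Psi> \<lrcorner> \<alpha> = 0"
  shows "exp_contract \<Psi> \<alpha> = \<alpha> + \<Psi> \<lrcorner> \<alpha>"
proof
  fix vs
  have zero: "(contract \<Psi> ^^ (k + 2)) \<alpha> = 0" for k
  proof (induction k)
    case 0
    show ?case using assms by (simp add: numeral_2_eq_2)
  next
    case (Suc k)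
    have "(contract \<Psi> ^^ (Suc k + 2)) \<alpha> = \<Psi> \<lrcorner> (contract \<Psi> ^^ (k + 2)) \<alpha>"
      by simp
    then show ?case by (simp only: Suc.IH contract_zero)
  qed
  have "exp_contract \<Psi> \<alpha> vs = (\<Sum>k<2. ((contract \<Psi> ^^ k) \<alpha>) vs / fact k)"
    unfolding exp_contract_def
  proof (rule suminf_finite)
    fix k :: nat assume "k \<notin> {..<2}"
    \<comment> \<open>Subtraction on naturals is exact here because \<open>k\<close> is at least
      2.\<close>
    then have "k = (k - 2) + 2" by simp
    with zero[of "k - 2"] have "(contract \<Psi> ^^ k) \<alpha> = 0" by metis
    then show "((contract \<Psi> ^^ k) \<alpha>) vs / fact k = 0" by simp
  qed simp
  then show "exp_contract \<Psi> \<alpha> vs = (\<alpha> + \<Psi> \<lrcorner> \<alpha>) vs"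
    by (simp add: numeral_2_eq_2)
qed

lemma exp_contract_unit_form [simp]: "exp_contract \<Psi> unit_form = unit_form"
  by (simp add: exp_contract_square_zero)

lemma exp_contract_beltrami: "exp_contract (beltrami P) (one_form u 0) = one_form u (u v* P)"
  by (subst exp_contract_square_zero) (simp_all add: contract_beltrami one_form_add)

lemma exp_contract_beltrami_cnj:
  "exp_contract (beltrami_cnj P) (one_form 0 v) = one_form (v v* map_matrix cnj P) v"
  by (subst exp_contract_square_zero) (simp_all add: contract_beltrami_cnj one_form_add)

section \<open>The extension map on 1-forms\<close>

lemma sum_lists_length_1: "(\<Sum>I\<in>{I. length I = Suc 0}. F I) = (\<Sum>i\<in>UNIV. F [i])"
  for F :: "'i::finite list \<Rightarrow> 'b::comm_monoid_add"
proof -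
  have "{I. length I = Suc 0} = range (\<lambda>i::'i. [i])"
    by (auto simp: length_Suc_conv)
  then show ?thesis
    by (simp add: sum.reindex inj_def)
qed

lemma sum_scale_axis: "(\<Sum>i\<in>UNIV. u $ i *s axis i 1) = u" for u :: "complex^'n::finite"
  by (simp add: vec_eq_iff axis_def if_distrib[of "(*) _"] cong: if_cong)

lemma sum_scale_axis_mult: "(\<Sum>i\<in>UNIV. u $ i *s (axis i 1 v* M)) = u v* M"
  for u :: "complex^'n::finite"
  by (simp add: vec_eq_iff vector_matrix_mult_def axis_def if_distrib[of "(*) _"] mult_ac
      cong: if_cong)

text \<open>The \<open>dzbar\<close> factor is the exponential of an empty wedge, that is
  \<open>unit_form\<close>, so only the exponentials of the single \<open>dz i\<close> remain to be
  recombined.\<close>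

lemma exp_exp_pq_10: "exp_exp_pq 1 0 P (one_form u v) = one_form u (u v* P)"
proof -
  have "one_form u v [frame (Inl i)] = u $ i" for i
    by (simp add: one_form_def frame_nth if_distrib[of "(*) _"] cong: if_cong)
  then show ?thesis
    by (simp add: exp_exp_pq_def sum_lists_length_1 wedge_list_def dz_eq_one_form
        exp_contract_beltrami fscale_one_form sum_one_form sum_scale_axis sum_scale_axis_mult)
qed

lemma exp_exp_pq_01: "exp_exp_pq 0 1 P (one_form u v) = one_form (v v* map_matrix cnj P) v"
proof -
  have "one_form u v [frame (Inr i)] = v $ i" for i
    by (simp add: one_form_def frame_nth if_distrib[of "(*) _"] cong: if_cong)
  then show ?thesis
    by (simp add: exp_exp_pq_def sum_lists_length_1 wedge_list_def dzbar_eq_one_form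
        exp_contract_beltrami_cnj fscale_one_form sum_one_form sum_scale_axis sum_scale_axis_mult)
qed

text \<open>The coefficients of type \<open>(a, b)\<close> are values on lists of length
  \<open>a + b\<close>, where a 1-form vanishes.\<close>

lemma exp_exp_pq_one_form_eq_0:
  assumes "a + b \<noteq> 1"
  shows "exp_exp_pq a b P (one_form u v) = 0"
  using assms by (simp add: exp_exp_pq_def one_form_def)

lemma exp_exp_one_form:
  fixes P :: "complex^'n::finite^'n"
  shows "exp_exp P (one_form u v) = one_form (u + v v* map_matrix cnj P) (v + u v* P)"
proof -
  let ?N = "{..CARD('n)}"
  let ?E = "\<lambda>(a, b). exp_exp_pq a b P (one_form u v)"
  have "exp_exp P (one_form u v) = (\<Sum>x\<in>?N \<times> ?N. ?E x)"
    by (simp add: exp_exp_def sum.cartesian_product)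
  also have "\<dots> = (\<Sum>x\<in>{(1, 0), (0, 1)}. ?E x)"
  proof (rule sum.mono_neutral_right)
    \<comment> \<open>Index types are nonempty, so degree 1 lies within the bound
      \<open>CARD('n)\<close>.\<close>
    show "{(1, 0), (0, 1)} \<subseteq> ?N \<times> ?N"
      by (simp add: Suc_le_eq)
    show "\<forall>x\<in>?N \<times> ?N - {(1, 0), (0, 1)}. ?E x = 0"
      by (auto intro!: exp_exp_pq_one_form_eq_0 simp: add_is_1)
  qed simp
  also have "\<dots> = one_form u (u v* P) + one_form (v v* map_matrix cnj P) v"
    using exp_exp_pq_10[of P u v] exp_exp_pq_01[of P u v] by simp
  finally show ?thesis
    by (simp add: one_form_add add.commute)
qed

section \<open>The exterior derivative in the coframe\<close>

text \<open>A real linear map is determined by its values on the real basis \<open>axis i 1\<close>,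
  \<open>axis i \<i>\<close>; expressing real and imaginary parts of \<open>w $ i\<close> through
  \<open>w $ i\<close> and its conjugate produces the Wirtinger coefficients.\<close>

lemma real_linear_wirtinger:
  fixes D :: "complex^'n::finite \<Rightarrow> complex"
  assumes "linear D"
  shows "D w = (\<Sum>i\<in>UNIV. (D (axis i 1) - \<i> * D (axis i \<i>)) / 2 * w $ i)
             + (\<Sum>i\<in>UNIV. (D (axis i 1) + \<i> * D (axis i \<i>)) / 2 * cnj (w $ i))"
proof -
  interpret linear D by fact
  have w: "w = (\<Sum>i\<in>UNIV. Re (w $ i) *\<^sub>R axis i 1 + Im (w $ i) *\<^sub>R axis i \<i>)"
    by (simp add: vec_eq_iff axis_def if_distrib[of "scaleR _"] sum.distrib complex_eq_iff cong: if_cong)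
  have "D w = (\<Sum>i\<in>UNIV. Re (w $ i) *\<^sub>R D (axis i 1) + Im (w $ i) *\<^sub>R D (axis i \<i>))"
    by (subst w) (simp add: sum add scaleR)
  also have "\<dots> = (\<Sum>i\<in>UNIV. (D (axis i 1) - \<i> * D (axis i \<i>)) / 2 * w $ i
             + (D (axis i 1) + \<i> * D (axis i \<i>)) / 2 * cnj (w $ i))"
  proof (rule sum.cong[OF refl])
    fix i
    have "Re z *\<^sub>R x + Im z *\<^sub>R y = (x - \<i> * y) / 2 * z + (x + \<i> * y) / 2 * cnj z" for x y z
      by (simp add: complex_eq_iff field_simps)
    then show "Re (w $ i) *\<^sub>R D (axis i 1) + Im (w $ i) *\<^sub>R D (axis i \<i>)
      = (D (axis i 1) - \<i> * D (axis i \<i>)) / 2 * w $ i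
             + (D (axis i 1) + \<i> * D (axis i \<i>)) / 2 * cnj (w $ i)" .
  qed
  finally show ?thesis by (simp add: sum.distrib)
qed

lemma del_eq_one_form: "del c f x = one_form (\<chi> i. chart_wirt c i f x) 0"
  by (simp add: del_def sum_fscale_dz)

lemma delbar_eq_one_form: "delbar c f x = one_form 0 (\<chi> i. chart_wirtbar c i f x)"
  by (simp add: delbar_def sum_fscale_dzbar)

lemma ext_d_eq_one_form:
  assumes "(f \<circ> chart_inv c) differentiable (at (snd c x))"
  shows "ext_d c f x = one_form (\<chi> i. chart_wirt c i f x) (\<chi> i. chart_wirtbar c i f x)"
proof -
  let ?D = "frechet_derivative (f \<circ> chart_inv c) (at (snd c x))"
  have D: "?D w = (\<Sum>i\<in>UNIV. chart_wirt c i f x * w $ i)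
      + (\<Sum>i\<in>UNIV. chart_wirtbar c i f x * cnj (w $ i))" for w
    unfolding chart_wirt_def chart_wirtbar_def wirt_def wirtbar_def
    by (rule real_linear_wirtinger[OF linear_frechet_derivative[OF assms]])
  have "?D (re_tangent v) + \<i> * ?D (im_tangent v) =
      (\<Sum>i\<in>UNIV. chart_wirt c i f x * v $ Inl i) + (\<Sum>i\<in>UNIV. chart_wirtbar c i f x * v $ Inr i)" for v
  proof -
    \<comment> \<open>Trades the division in \<open>im_tangent\<close> for a multiplication, so that
      real and imaginary parts can be compared directly.\<close>
    have div_2i: "z / (2 * \<i>) = - (\<i> * z) / 2" for z
      by (simp add: complex_eq_iff Re_divide Im_divide power2_eq_square)
    \<comment> \<open>Complex linear extension turns the coordinates \<open>w $ i\<close> and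
      \<open>cnj (w $ i)\<close> of a real tangent vector into the independent components
      \<open>Inl i\<close> and \<open>Inr i\<close> of \<open>v\<close>.\<close>
    have re: "re_tangent v $ i + \<i> * im_tangent v $ i = v $ Inl i" for i
      by (simp add: re_tangent_def im_tangent_def div_2i complex_eq_iff field_simps)
    have im: "cnj (re_tangent v $ i) + \<i> * cnj (im_tangent v $ i) = v $ Inr i" for i
      by (simp add: re_tangent_def im_tangent_def div_2i complex_eq_iff field_simps)
    have "?D (re_tangent v) + \<i> * ?D (im_tangent v) =
        (\<Sum>i\<in>UNIV. chart_wirt c i f x * (re_tangent v $ i + \<i> * im_tangent v $ i))
      + (\<Sum>i\<in>UNIV. chart_wirtbar c i f x
            * (cnj (re_tangent v $ i) + \<i> * cnj (im_tangent v $ i)))"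
      by (simp add: D distrib_left sum.distrib sum_distrib_left mult.left_commute)
    then show ?thesis
      by (simp only: re im)
  qed
  then show ?thesis
    by (simp add: ext_d_def one_form_def fun_eq_iff)
qed

section \<open>The matrix identity\<close>

lemma matrix_diff_ldistrib: "A ** (B - C) = A ** B - A ** C" for A :: "'a::ring_1^'n^'m"
  by (simp add: vec_eq_iff matrix_matrix_mult_def sum_subtractf right_diff_distrib)

lemma matrix_diff_rdistrib: "(A - B) ** C = A ** C - B ** C" for A :: "'a::ring_1^'n^'m"
  by (simp add: vec_eq_iff matrix_matrix_mult_def sum_subtractf left_diff_distrib)

lemma matrix_inv_inverse:
  assumes "invertible A"
  shows "A ** matrix_inv A = mat 1" "matrix_inv A ** A = mat 1"
  using someI_ex[OF assms[unfolded invertible_def]] by (simp_all add: matrix_inv_def)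

text \<open>Both sides arise from \<open>Q ** (mat 1 - P ** Q) = (mat 1 - Q ** P) ** Q\<close> by
  multiplying with one inverse on each side.\<close>

lemma push_through_inverse:
  fixes P Q :: "complex^'n^'n"
  assumes "invertible (mat 1 - P ** Q)" "invertible (mat 1 - Q ** P)"
  shows "matrix_inv (mat 1 - Q ** P) ** Q = Q ** matrix_inv (mat 1 - P ** Q)"
proof -
  let ?R = "mat 1 - P ** Q" and ?S = "mat 1 - Q ** P"
  have "Q ** ?R = ?S ** Q"
    by (simp add: matrix_diff_ldistrib matrix_diff_rdistrib matrix_mul_assoc)
  then have "matrix_inv ?S ** (Q ** ?R) ** matrix_inv ?R = matrix_inv ?S ** (?S ** Q) ** matrix_inv ?R"
    by simp
  then show ?thesis
    \<comment> \<open>Association to the left cancels the inverse on the left; association to the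
      right then cancels the other one.\<close>
    by (simp add: matrix_mul_assoc matrix_inv_inverse assms)
       (simp flip: matrix_mul_assoc add: matrix_inv_inverse assms)
qed

text \<open>\<open>Q\<close> is kept independent of \<open>P\<close> so that exchanging
  \<open>P\<close> with \<open>Q\<close> and \<open>u\<close> with \<open>v\<close> yields the
  \<open>dzbar\<close> component from the same statement.\<close>

lemma solve_coefficients:
  fixes P Q :: "complex^'n^'n"
  assumes "invertible (mat 1 - P ** Q)" "invertible (mat 1 - Q ** P)"
  shows "(u - v v* Q) v* matrix_inv (mat 1 - P ** Q)
       + ((v - u v* P) v* matrix_inv (mat 1 - Q ** P)) v* Q = u"
proof -
  let ?R = "mat 1 - P ** Q"
  \<comment> \<open>Moving the inverse past \<open>Q\<close> makes it a common right factor of both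
    summands.\<close>
  have "((v - u v* P) v* matrix_inv (mat 1 - Q ** P)) v* Q = (v - u v* P) v* Q v* matrix_inv ?R"
    by (simp add: vector_matrix_mul_assoc push_through_inverse[OF assms])
  then have "(u - v v* Q) v* matrix_inv ?R + ((v - u v* P) v* matrix_inv (mat 1 - Q ** P)) v* Q
      = (u - v v* Q + (v - u v* P) v* Q) v* matrix_inv ?R"
    by (simp add: vector_matrix_left_distrib)
  \<comment> \<open>The terms in \<open>v\<close> cancel, leaving \<open>u\<close> minus
    \<open>u\<close> times \<open>P ** Q\<close>.\<close>
  also have "u - v v* Q + (v - u v* P) v* Q = u v* ?R"
    by (simp add: vector_matrix_mult_diff_distrib vector_matrix_mult_diff_rdistrib vector_matrix_mul_assoc)
  also have "u v* ?R v* matrix_inv ?R = u"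
    by (simp add: vector_matrix_mul_assoc matrix_inv_inverse(1)[OF assms(1)])
  finally show ?thesis .
qed

theorem proposition1p5:
  fixes X :: "'p topology"
    and A :: "('p, 'n::finite option) chart set"
    and r :: real
    and p :: "'p \<Rightarrow> complex"
    and \<sigma> :: "'p \<Rightarrow> 'p"
    and \<phi> :: "complex \<Rightarrow> ('p, 'n) chart \<Rightarrow> 'p \<Rightarrow> complex^'n^'n"
    and t :: complex
    and f :: "'p \<Rightarrow> complex"
  assumes "holomorphic_family X A r p"
    and "transv_holo_trivialization X A r p \<sigma>"
    and "kuranishi_data X A r p \<sigma> \<phi>"
    and "t \<in> ball 0 r"
    and "\<forall>c\<in>fibre_charts X A p 0. \<forall>x\<in>fst c.
           invertible (one_minus_phi_phibar (\<phi> t c x)) \<and>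
           invertible (one_minus_phibar_phi (\<phi> t c x))"
    and "smooth_function (fibre_charts X A p 0) f"
  shows "\<forall>c\<in>fibre_charts X A p 0. \<forall>x\<in>fst c.
    ext_d c f x =
      exp_exp (\<phi> t c x)
        (vform10 (matrix_inv (one_minus_phi_phibar (\<phi> t c x)))
           \<lrcorner> (del c f x - beltrami_cnj (\<phi> t c x) \<lrcorner> delbar c f x)
         + vform01 (matrix_inv (one_minus_phibar_phi (\<phi> t c x)))
           \<lrcorner> (delbar c f x - beltrami (\<phi> t c x) \<lrcorner> del c f x))"
proof (intro ballI)
  fix c x
  assume c: "c \<in> fibre_charts X A p 0" and x: "x \<in> fst c"
  define P where "P = \<phi> t c x"
  have inv: "invertible (mat 1 - P ** map_matrix cnj P)" "invertible (mat 1 - map_matrix cnj P ** P)"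
    using assms(5) c x
    by (auto simp: P_def simp flip: one_minus_phi_phibar_eq one_minus_phibar_phi_eq)
  \<comment> \<open>Smoothness for the empty list of directions is differentiability of the function
    itself.\<close>
  have "iter_deriv [] (f \<circ> chart_inv c) differentiable (at (snd c x))"
    using assms(6) c x unfolding smooth_function_def smooth_on_def by blast
  then have "(f \<circ> chart_inv c) differentiable (at (snd c x))"
    by simp
  \<comment> \<open>Both sides become \<open>one_form\<close> terms;
    \<open>solve_coefficients\<close> is used for the \<open>dz\<close> row and, with the roles
    exchanged, for the \<open>dzbar\<close> row.\<close>
  then show "ext_d c f x =
      exp_exp (\<phi> t c x)
        (vform10 (matrix_inv (one_minus_phi_phibar (\<phi> t c x)))
           \<lrcorner> (del c f x - beltrami_cnj (\<phi> t c x) \<lrcorner> delbar c f x)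
         + vform01 (matrix_inv (one_minus_phibar_phi (\<phi> t c x)))
           \<lrcorner> (delbar c f x - beltrami (\<phi> t c x) \<lrcorner> del c f x))"
    by (simp add: ext_d_eq_one_form del_eq_one_form delbar_eq_one_form contract_beltrami
        contract_beltrami_cnj one_form_diff contract_vform10 contract_vform01 one_form_add
        exp_exp_one_form one_minus_phi_phibar_eq one_minus_phibar_phi_eq solve_coefficients inv
        flip: P_def)
qed

end
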